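(* The discrete dynamical systems $(Q_2,\ell,\sigma)$ and $([0,1],d_2^*,f_2)$ are topologically conjugate, where $f_2$ is the 2-tent map, $Q_2$ is the set of its $L$-$R$ symbol sequences with metric $\ell$ and shift map $\sigma$, and $d_2^*$ is the metric on $[0,1]$ transported from $\ell$ (all defined in the context).
   Context: The 2-tent map $f_2:[0,1]\to[0,1]$ is $f_2(x)=2x$ if $0\le x<\frac12$ and $f_2(x)=2(1-x)$ if $\frac12\le x\le1$. $Q_2$ is the set of itineraries of points of $[0,1]$ under $f_2$: the itinerary of $x$ is the infinite sequence over $\{L,R\}$ whose $n$th symbol is $L$ if $f_2^{n-1}(x)\in[0,\frac12)$ and $R$ if $f_2^{n-1}(x)\in[\frac12,1]$. Equivalently, $Q_2$ is the set of all infinite one-sided sequences over $\{L,R\}$ that do not have $LRLLLL\dots$ as a suffix. The shift map $\sigma:Q_2\to Q_2$ deletes the first symbol. The metric $\ell$ on $Q_2$ is $\ell(x,y)=2^{-k}$ if $x\ne y$, where $k$ is the length of the longest prefix shared by $x$ and $y$, and $\ell(x,x)=0$. The bijection $h_2:Q_2\to[0,1]$ sends a sequence $s_1s_2s_3\dots$ to the number whose itinerary it is; explicitly, $h_2(s_1s_2s_3\dots)=\sum_{i\ge1}\chi_i2^{-i}$, where $\chi_i\in\{0,1\}$ is the parity of the number of $R$'s among $s_1,\dots,s_i$. The metric $d_2^*$ on $[0,1]$ is $d_2^*(x,y)=\ell(h_2^{-1}(x),h_2^{-1}(y))$. Two discrete dynamical systems $(X_1,d_1,g_1)$ and $(X_2,d_2,g_2)$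 (sets with metrics $d_i$ and functions $g_i:X_i\to X_i$) are topologically conjugate if and only if there exists a homeomorphism $g:X_1\to X_2$ (for the metric topologies) with $g\circ g_1=g_2\circ g$. *)

theory Defs
  imports "HOL-Analysis.Analysis"
begin

definition discrete_dynamical_system ::
  "'a set \<Rightarrow> ('a \<Rightarrow> 'a \<Rightarrow> real) \<Rightarrow> ('a \<Rightarrow> 'a) \<Rightarrow> bool" where
  "discrete_dynamical_system X d g \<longleftrightarrow> Metric_space X d \<and> g ` X \<subseteq> X"

text \<open>Both triples are required to be dynamical systems: outside of metric spaces
  \<open>Metric_space.mtopology\<close> has no meaning.\<close>

definition topologically_conjugate ::
  "'a set \<Rightarrow> ('a \<Rightarrow> 'a \<Rightarrow> real) \<Rightarrow> ('a \<Rightarrow> 'a) \<Rightarrow>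
   'b set \<Rightarrow> ('b \<Rightarrow> 'b \<Rightarrow> real) \<Rightarrow> ('b \<Rightarrow> 'b) \<Rightarrow> bool" where
  "topologically_conjugate X1 d1 g1 X2 d2 g2 \<longleftrightarrow>
     discrete_dynamical_system X1 d1 g1 \<and>
     discrete_dynamical_system X2 d2 g2 \<and>
     (\<exists>g. homeomorphic_map (Metric_space.mtopology X1 d1) (Metric_space.mtopology X2 d2) g \<and>
          (\<forall>x\<in>X1. g (g1 x) = g2 (g x)))"

definition tent :: "real \<Rightarrow> real" where
  "tent x = (if x < 1/2 then 2 * x else 2 * (1 - x))"

datatype symbol = L | R

text \<open>Sequences are indexed from 0, so \<open>s n\<close> is the symbol in position \<open>n + 1\<close>.\<close>

definition itinerary :: "real \<Rightarrow> nat \<Rightarrow> symbol" where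
  "itinerary x = (\<lambda>n. if (tent ^^ n) x \<in> {0..<1/2} then L else R)"

definition Q2 :: "(nat \<Rightarrow> symbol) set" where
  "Q2 = itinerary ` {0..1}"

definition shift :: "(nat \<Rightarrow> symbol) \<Rightarrow> (nat \<Rightarrow> symbol)" where
  "shift s = (\<lambda>n. s (Suc n))"

definition common_prefix_length :: "(nat \<Rightarrow> symbol) \<Rightarrow> (nat \<Rightarrow> symbol) \<Rightarrow> nat" where
  "common_prefix_length s t = (GREATEST k. \<forall>i<k. s i = t i)"

definition ell :: "(nat \<Rightarrow> symbol) \<Rightarrow> (nat \<Rightarrow> symbol) \<Rightarrow> real" where
  "ell s t = (if s = t then 0 else 1 / 2 ^ common_prefix_length s t)"

definition h2 :: "(nat \<Rightarrow> symbol) \<Rightarrow> real" where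
  "h2 s = (THE x. x \<in> {0..1} \<and> itinerary x = s)"

definition d2_star :: "real \<Rightarrow> real \<Rightarrow> real" where
  "d2_star x y = ell (inv_into Q2 h2 x) (inv_into Q2 h2 y)"

end

(* The tent map f doubles the distance of two points on the same side of 1/2, so two points of
   [0,1] with the same itinerary satisfy 2^n |x - y| = |f^n x - f^n y| <= 1 for every n and coincide.
   Hence h2 is the inverse of the itinerary map; it is an isometry because d2_star is the
   transported metric, and it intertwines the shift with the tent map because deleting the first
   symbol of the itinerary of x gives the itinerary of tent x. *)
theory Submission
  imports Defs
begin

text \<open>Any index at which the sequences differ bounds the lengths of their shared prefixes, so
  \<open>GREATEST\<close> picks an attained maximum; agreement then passes down to every shorter
  prefix.\<close>

lemma le_common_prefix_length_iff:
  assumes "s \<noteq> t"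
  shows "j \<le> common_prefix_length s t \<longleftrightarrow> (\<forall>i<j. s i = t i)"
proof -
  obtain n where n: "s n \<noteq> t n"
    using assms by auto
  have bound: "k \<le> n" if "\<forall>i<k. s i = t i" for k
    using n that by (meson not_le)
  have "\<forall>i<common_prefix_length s t. s i = t i"
    unfolding common_prefix_length_def
    by (rule GreatestI_nat[where P = "\<lambda>k. \<forall>i<k. s i = t i" and k = 0 and b = n])
      (use bound in auto)
  moreover have "j \<le> common_prefix_length s t" if "\<forall>i<j. s i = t i"
    unfolding common_prefix_length_def
    by (rule Greatest_le_nat[where P = "\<lambda>k. \<forall>i<k. s i = t i" and b = n])
      (use bound that in auto)
  ultimately show ?thesis
    by auto
qed

text \<open>Replaces estimates of \<open>ell\<close> by agreement of prefixes. Equal sequences fit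
  in as well, since both sides are then true.\<close>

lemma ell_le_iff: "ell s t \<le> 1 / 2 ^ j \<longleftrightarrow> (\<forall>i<j. s i = t i)"
proof (cases "s = t")
  case False
  then have "ell s t \<le> 1 / 2 ^ j \<longleftrightarrow> j \<le> common_prefix_length s t"
    by (simp add: ell_def divide_simps)
  then show ?thesis
    using le_common_prefix_length_iff[OF False] by simp
qed (simp add: ell_def)

lemma ell_nonneg: "0 \<le> ell s t"
  by (simp add: ell_def)

lemma ell_eq_0_iff: "ell s t = 0 \<longleftrightarrow> s = t"
  by (simp add: ell_def)

lemma ell_commute: "ell s t = ell t s"
  unfolding ell_def common_prefix_length_def by (simp add: eq_commute)

text \<open>Agreement is transitive: \<open>s\<close> and \<open>u\<close> coincide at least along
  the shorter of the prefixes that each shares with \<open>t\<close>.\<close>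

lemma ell_ultrametric: "ell s u \<le> max (ell s t) (ell t u)"
proof (cases "s = t \<or> t = u")
  case True
  then show ?thesis
    by auto
next
  case False
  define j where "j = min (common_prefix_length s t) (common_prefix_length t u)"
  have "\<forall>i<j. s i = t i" "\<forall>i<j. t i = u i"
    using False le_common_prefix_length_iff[of s t j] le_common_prefix_length_iff[of t u j]
    by (simp_all add: j_def)
  then have "ell s u \<le> 1 / 2 ^ j"
    by (simp add: ell_le_iff)
  \<comment> \<open>The shorter prefix belongs to the larger distance, so the two sides are in fact
    equal.\<close>
  also have "\<dots> \<le> max (ell s t) (ell t u)"
    using False by (auto simp: j_def ell_def min_def)
  finally show ?thesis .
qed

lemma Metric_space_ell: "Metric_space X ell"
proof
  show "ell s u \<le> ell s t + ell t u" for s t u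
    using ell_ultrametric[of s u t] ell_nonneg[of s t] ell_nonneg[of t u] by linarith
qed (simp_all add: ell_nonneg ell_eq_0_iff ell_commute)

lemma tent_funpow_in_unit: "x \<in> {0..1} \<Longrightarrow> (tent ^^ n) x \<in> {0..1}"
  by (induction n) (auto simp: tent_def)

lemma tent_in_unit: "x \<in> {0..1} \<Longrightarrow> tent x \<in> {0..1}"
  using tent_funpow_in_unit[of x 1] by simp

lemma itinerary_tent: "itinerary (tent x) = shift (itinerary x)"
  by (simp add: itinerary_def shift_def fun_eq_iff funpow_swap1)

lemma abs_tent_diff_same_side:
  assumes "x < 1/2 \<longleftrightarrow> y < 1/2"
  shows "\<bar>tent x - tent y\<bar> = 2 * \<bar>x - y\<bar>"
  using assms by (auto simp: tent_def abs_if)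

lemma inj_on_itinerary: "inj_on itinerary {0..1}"
proof (rule inj_onI)
  fix x y :: real
  assume x: "x \<in> {0..1}" and y: "y \<in> {0..1}" and eq: "itinerary x = itinerary y"
  \<comment> \<open>The orbits stay in the unit interval, so the symbol \<open>L\<close> means
    exactly that the iterate is below 1/2.\<close>
  have same_side: "(tent ^^ n) x < 1/2 \<longleftrightarrow> (tent ^^ n) y < 1/2" for n
    using fun_cong[OF eq, of n] tent_funpow_in_unit[OF x, of n] tent_funpow_in_unit[OF y, of n]
    by (auto simp: itinerary_def split: if_splits)
  have expand: "\<bar>(tent ^^ n) x - (tent ^^ n) y\<bar> = 2 ^ n * \<bar>x - y\<bar>" for n
    by (induction n) (simp_all add: abs_tent_diff_same_side[OF same_side])
  have bound: "2 ^ n * \<bar>x - y\<bar> \<le> 1" for n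
    using expand[of n] tent_funpow_in_unit[OF x, of n] tent_funpow_in_unit[OF y, of n] by auto
  show "x = y"
  proof (rule ccontr)
    assume "x \<noteq> y"
    then obtain n where "1 / \<bar>x - y\<bar> < 2 ^ n"
      using real_arch_pow[of 2 "1 / \<bar>x - y\<bar>"] by auto
    then show False
      using bound[of n] \<open>x \<noteq> y\<close> by (simp add: divide_simps)
  qed
qed

text \<open>Injectivity of \<open>itinerary\<close> supplies the uniqueness that the definite
  description in \<open>h2\<close> demands.\<close>

lemma h2_itinerary: "x \<in> {0..1} \<Longrightarrow> h2 (itinerary x) = x"
  unfolding h2_def using inj_onD[OF inj_on_itinerary] by (intro the_equality) blast+

lemma bij_betw_h2: "bij_betw h2 Q2 {0..1}"
  by (rule bij_betw_byWitness[where f' = itinerary]) (auto simp: Q2_def h2_itinerary)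

lemma Metric_space_d2_star: "Metric_space {0..1} d2_star"
proof
  have inj: "inj_on (inv_into Q2 h2) {0..1}"
    using bij_betw_inv_into[OF bij_betw_h2] by (rule bij_betw_imp_inj_on)
  show "d2_star x y = 0 \<longleftrightarrow> x = y" if "x \<in> {0..1}" "y \<in> {0..1}" for x y
    using inj_on_eq_iff[OF inj that] by (simp add: d2_star_def ell_eq_0_iff)
  \<comment> \<open>Taking \<open>ell\<close> as a metric on all sequences avoids checking that the
    preimages lie in \<open>Q2\<close>.\<close>
  show "d2_star x z \<le> d2_star x y + d2_star y z" for x y z
    unfolding d2_star_def by (rule Metric_space.triangle[OF Metric_space_ell[of UNIV]]) auto
qed (simp_all add: d2_star_def ell_nonneg ell_commute)

lemma d2_star_h2: "s \<in> Q2 \<Longrightarrow> t \<in> Q2 \<Longrightarrow> d2_star (h2 s) (h2 t) = ell s t"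
  by (simp add: d2_star_def bij_betw_inv_into_left[OF bij_betw_h2])

text \<open>The shifted itinerary of \<open>x\<close> is that of \<open>tent x\<close>, which is
  again a point of the unit interval.\<close>

lemma shift_Q2: "shift ` Q2 \<subseteq> Q2"
proof -
  have "shift (itinerary x) \<in> Q2" if "x \<in> {0..1}" for x
    using tent_in_unit[OF that] by (simp add: Q2_def flip: itinerary_tent)
  then show ?thesis
    by (auto simp: Q2_def)
qed

lemma h2_shift: "s \<in> Q2 \<Longrightarrow> h2 (shift s) = tent (h2 s)"
  using tent_in_unit by (auto simp: Q2_def h2_itinerary simp flip: itinerary_tent)

theorem mainTheorem8:
  shows "topologically_conjugate Q2 ell shift {0..1} d2_star tent"
proof -
  interpret Metric_space12 Q2 ell "{0..1}" d2_star
    by (intro Metric_space12.intro Metric_space_ell Metric_space_d2_star)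
  \<comment> \<open>A distance-preserving surjection between metric spaces is a
    homeomorphism.\<close>
  have "homeomorphic_map M1.mtopology M2.mtopology h2"
    using bij_betw_imp_surj_on[OF bij_betw_h2] d2_star_h2
    by (rule isometry_imp_homeomorphic_map)
  then show ?thesis
    unfolding topologically_conjugate_def discrete_dynamical_system_def
    using Metric_space_ell Metric_space_d2_star shift_Q2 tent_in_unit h2_shift by blast
qed

end
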